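(* Let $I$ be a finite index set. For each $i\in I$ let $X_i$ be a finite set, and let $X=\prod_{i\in I}X_i$, so that $C(X)=\bigotimes_i C(X_i)$. For each $i\in I$ let $\tilde X_i=\prod\{X_j: j\neq i\}$, so that $C(X)=C(X_i)\otimes C(\tilde X_i)$. Define a seminorm $L_i$ on $C(X)$ by $$L_i(f)=2\|f\|_{C(X)/C(\tilde X_i)}$$ for any $f\in C(X)$. Then for every $\mathbb{R}$-valued $f\in C(X)$, $$L_H(f)=\max\{L_i(f): i\in I\}.$$
   Context: $C(X)$ is the algebra of $\mathbb{C}$-valued functions on the finite set $X$ with the supremum norm $\|\cdot\|_\infty$. $C(\tilde X_i)$ is viewed as the subalgebra of $C(X)$ consisting of functions that do not depend on the $i$-th coordinate, and $\|f\|_{C(X)/C(\tilde X_i)}=\inf\{\|f-k\|_\infty: k\in C(\tilde X_i)\}$ is the pull-back to $C(X)$ of the quotient norm. The Hamming metric $d_H$ on $X$ is given by letting $d_H(x,y)$ be the number of $i\in I$ with $x_i\neq y_i$, and $L_H$ is its Lipschitz seminorm: $L_H(f)=\sup\{|f(x)-f(y)|/d_H(x,y): x,y\in X,\ x\neq y\}$ (supremum over the empty set being $0$). *)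

theory Defs
  imports Complex_Main "HOL-Library.FuncSet"
begin

text \<open>The factors X_i (i in I) are finite subsets of a common type, which is no restriction for
  a finite family of finite sets; the product is the extensional \<open>PiE I X\<close>. Factors may be empty,
  and so may \<open>I\<close>.\<close>

text \<open>\<open>Sup {}\<close> is unspecified on the reals, so suprema of sets of nonnegative reals get the
  value 0 on the empty set by an explicit convention.\<close>

definition sup0 :: "real set \<Rightarrow> real" where
  "sup0 A = (if A = {} then 0 else Sup A)"

definition C :: "'x set \<Rightarrow> ('x \<Rightarrow> complex) set" where
  "C S = (S \<rightarrow>\<^sub>E UNIV)"

definition sup_norm :: "'x set \<Rightarrow> ('x \<Rightarrow> complex) \<Rightarrow> real" where
  "sup_norm S f = sup0 ((\<lambda>x. cmod (f x)) ` S)"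

text \<open>C of the product of the X_j with j different from i, viewed inside C of the full product:
  the functions that do not depend on the i-th coordinate.\<close>

definition C_tilde :: "'i set \<Rightarrow> ('i \<Rightarrow> 'a set) \<Rightarrow> 'i \<Rightarrow> (('i \<Rightarrow> 'a) \<Rightarrow> complex) set" where
  "C_tilde I X i = {k \<in> C (PiE I X).
     \<forall>x\<in>PiE I X. \<forall>y\<in>PiE I X. (\<forall>j\<in>I - {i}. x j = y j) \<longrightarrow> k x = k y}"

definition quotient_norm :: "'x set \<Rightarrow> ('x \<Rightarrow> complex) set \<Rightarrow> ('x \<Rightarrow> complex) \<Rightarrow> real" where
  "quotient_norm S K f = (INF k\<in>K. sup_norm S (\<lambda>x. f x - k x))"

definition L_coord :: "'i set \<Rightarrow> ('i \<Rightarrow> 'a set) \<Rightarrow> 'i \<Rightarrow> (('i \<Rightarrow> 'a) \<Rightarrow> complex) \<Rightarrow> real" where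
  "L_coord I X i f = 2 * quotient_norm (PiE I X) (C_tilde I X i) f"

definition hamming_dist :: "'i set \<Rightarrow> ('i \<Rightarrow> 'a) \<Rightarrow> ('i \<Rightarrow> 'a) \<Rightarrow> nat" where
  "hamming_dist I x y = card {i \<in> I. x i \<noteq> y i}"

definition lipschitz_seminorm :: "'x set \<Rightarrow> ('x \<Rightarrow> 'x \<Rightarrow> real) \<Rightarrow> ('x \<Rightarrow> complex) \<Rightarrow> real" where
  "lipschitz_seminorm S d f = sup0 {cmod (f x - f y) / d x y | x y. x \<in> S \<and> y \<in> S \<and> x \<noteq> y}"

definition L_H :: "'i set \<Rightarrow> ('i \<Rightarrow> 'a set) \<Rightarrow> (('i \<Rightarrow> 'a) \<Rightarrow> complex) \<Rightarrow> real" where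
  "L_H I X f = lipschitz_seminorm (PiE I X) (\<lambda>x y. real (hamming_dist I x y)) f"

end

theory Submission
  imports Defs
begin

text \<open>Along the \<open>i\<close>-th coordinate, twice the quotient norm of a real function is the largest
  oscillation of \<open>f\<close> on a fibre: the midpoint of the range of \<open>f\<close> on each fibre is a best
  approximation not depending on the \<open>i\<close>-th coordinate. Points of a fibre have Hamming distance
  at most 1, and conversely any two points are joined by a path that changes one coordinate at a
  time and has as many steps as their Hamming distance.\<close>

lemma sup0_upper: "finite A \<Longrightarrow> a \<in> A \<Longrightarrow> a \<le> sup0 A"
  unfolding sup0_def by (auto intro!: cSup_upper bdd_above_finite)

text \<open>The bound has to be nonnegative because \<open>sup0 {}\<close> is 0.\<close>

lemma sup0_least: "0 \<le> B \<Longrightarrow> (\<And>a. a \<in> A \<Longrightarrow> a \<le> B) \<Longrightarrow> sup0 A \<le> B"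
  unfolding sup0_def by (auto intro: cSup_least)

lemma sup0_nonneg: "finite A \<Longrightarrow> (\<And>a. a \<in> A \<Longrightarrow> 0 \<le> a) \<Longrightarrow> 0 \<le> sup0 A"
  by (cases "A = {}") (simp add: sup0_def, meson all_not_in_conv order_trans sup0_upper)

lemma norm_le_sup_norm: "finite S \<Longrightarrow> x \<in> S \<Longrightarrow> cmod (f x) \<le> sup_norm S f"
  unfolding sup_norm_def by (rule sup0_upper) auto

lemma sup_norm_nonneg: "finite S \<Longrightarrow> 0 \<le> sup_norm S f"
  unfolding sup_norm_def by (rule sup0_nonneg) auto

lemma norm_diff_le_lipschitz_seminorm:
  assumes "finite S" "x \<in> S" "y \<in> S" "x \<noteq> y" "0 < d x y"
  shows "cmod (f x - f y) \<le> lipschitz_seminorm S d f * d x y"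
proof -
  have "finite ((\<lambda>(x, y). cmod (f x - f y) / d x y) ` (S \<times> S))"
    using assms by blast
  then have "finite {cmod (f x - f y) / d x y | x y. x \<in> S \<and> y \<in> S \<and> x \<noteq> y}"
    by (rule rev_finite_subset) auto
  then have "cmod (f x - f y) / d x y \<le> lipschitz_seminorm S d f"
    unfolding lipschitz_seminorm_def by (rule sup0_upper) (use assms in blast)
  then show ?thesis
    using assms by (simp add: field_simps)
qed

lemma lipschitz_seminorm_nonneg:
  assumes "finite S" "\<And>x y. 0 \<le> d x y"
  shows "0 \<le> lipschitz_seminorm S d f"
proof -
  have "finite ((\<lambda>(x, y). cmod (f x - f y) / d x y) ` (S \<times> S))"
    using assms by blast
  then have "finite {cmod (f x - f y) / d x y | x y. x \<in> S \<and> y \<in> S \<and> x \<noteq> y}"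
    by (rule rev_finite_subset) auto
  then show ?thesis
    unfolding lipschitz_seminorm_def by (rule sup0_nonneg) (use assms in auto)
qed

text \<open>The zero function is a witness. Lower bounds on the infimum in
  \<open>quotient_norm\<close> rely on this, as \<open>Inf {}\<close> is unspecified on the
  reals.\<close>

lemma C_tilde_nonempty: "C_tilde I X i \<noteq> {}"
proof -
  have "restrict (\<lambda>_. 0) (PiE I X) \<in> C_tilde I X i"
    unfolding C_tilde_def C_def by auto
  then show ?thesis by blast
qed

text \<open>Every admissible \<open>k\<close> takes one value at both points, so the errors of
  \<open>k\<close> at \<open>x\<close> and at \<open>y\<close> together account for
  \<open>f x - f y\<close>. These two errors are the source of the factor 2 in
  \<open>L_coord\<close>.\<close>

lemma norm_diff_le_L_coord:
  assumes fin: "finite (PiE I X)"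
    and x: "x \<in> PiE I X" and y: "y \<in> PiE I X" and eq: "\<And>j. j \<in> I - {i} \<Longrightarrow> x j = y j"
  shows "cmod (f x - f y) \<le> L_coord I X i f"
proof -
  have "cmod (f x - f y) / 2 \<le> sup_norm (PiE I X) (\<lambda>x. f x - k x)" if "k \<in> C_tilde I X i" for k
  proof -
    have "k x = k y"
      using that x y eq unfolding C_tilde_def by blast
    then have "cmod (f x - f y) \<le> cmod (f x - k x) + cmod (f y - k y)"
      using norm_triangle_ineq4[of "f x - k x" "f y - k y"] by simp
    then show ?thesis
      using norm_le_sup_norm[OF fin x, of "\<lambda>x. f x - k x"]
        norm_le_sup_norm[OF fin y, of "\<lambda>x. f x - k x"] by linarith
  qed
  then have "cmod (f x - f y) / 2 \<le> quotient_norm (PiE I X) (C_tilde I X i) f"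
    unfolding quotient_norm_def by (intro cINF_greatest C_tilde_nonempty)
  then show ?thesis
    unfolding L_coord_def by simp
qed

text \<open>Real values of diameter at most \<open>B\<close> lie within \<open>B / 2\<close> of
  their midpoint. This fails in the complex plane, where an equilateral triangle of side
  \<open>B\<close> fits in no disc of radius \<open>B / 2\<close>.\<close>

lemma L_coord_le:
  assumes fin: "finite (PiE I X)" and real: "\<And>x. x \<in> PiE I X \<Longrightarrow> f x \<in> \<real>" and B: "0 \<le> B"
    and osc: "\<And>x y. x \<in> PiE I X \<Longrightarrow> y \<in> PiE I X \<Longrightarrow> (\<And>j. j \<in> I - {i} \<Longrightarrow> x j = y j)
      \<Longrightarrow> cmod (f x - f y) \<le> B"
  shows "L_coord I X i f \<le> B"
proof -
  \<comment> \<open>\<open>F x\<close> is the fibre through \<open>x\<close> in direction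
    \<open>i\<close>, and \<open>R x\<close> is the range of \<open>f\<close> on it. Points of one
    fibre share both, which puts \<open>k\<close> in \<open>C_tilde\<close>.\<close>
  define F where "F x = {y \<in> PiE I X. \<forall>j\<in>I - {i}. y j = x j}" for x
  define R where "R x = (\<lambda>y. Re (f y)) ` F x" for x
  define k where
    "k = restrict (\<lambda>x. complex_of_real ((Max (R x) + Min (R x)) / 2)) (PiE I X)"
  have k: "k \<in> C_tilde I X i"
  proof -
    have "k x = k y" if "x \<in> PiE I X" "y \<in> PiE I X" "\<forall>j\<in>I - {i}. x j = y j" for x y
    proof -
      have "F x = F y"
        using that unfolding F_def by auto
      then show ?thesis
        using that unfolding k_def R_def by simp
    qed
    moreover have "k \<in> C (PiE I X)"
      unfolding k_def C_def by auto
    ultimately show ?thesis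
      unfolding C_tilde_def by blast
  qed
  have "cmod (f x - k x) \<le> B / 2" if x: "x \<in> PiE I X" for x
  proof -
    have finR: "finite (R x)"
      unfolding R_def F_def using fin by simp
    have mem: "Re (f x) \<in> R x"
      unfolding R_def F_def using x by blast
    \<comment> \<open>Both extremes are attained on the fibre of \<open>x\<close>, so
      \<open>osc\<close> bounds the length of the range by \<open>B\<close>.\<close>
    then have "Max (R x) \<in> R x" "Min (R x) \<in> R x"
      using finR by (auto intro!: Max_in Min_in)
    then obtain u v where uv: "u \<in> F x" "v \<in> F x" "Max (R x) = Re (f u)" "Min (R x) = Re (f v)"
      unfolding R_def by (elim imageE) simp
    have "cmod (f u - f v) \<le> B"
      by (rule osc) (use uv in \<open>auto simp: F_def\<close>)
    then have "Max (R x) - Min (R x) \<le> B"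
      using complex_Re_le_cmod[of "f u - f v"] uv by simp
    moreover have "Min (R x) \<le> Re (f x)" "Re (f x) \<le> Max (R x)"
      using finR mem by auto
    ultimately have "\<bar>Re (f x) - (Max (R x) + Min (R x)) / 2\<bar> \<le> B / 2"
      unfolding abs_le_iff by (auto simp: field_simps)
    moreover have "f x - k x = complex_of_real (Re (f x) - (Max (R x) + Min (R x)) / 2)"
      using real[OF x] x unfolding k_def by (simp add: of_real_Re)
    ultimately show ?thesis
      by (simp only: norm_of_real)
  qed
  then have "sup_norm (PiE I X) (\<lambda>x. f x - k x) \<le> B / 2"
    unfolding sup_norm_def by (intro sup0_least) (use B in auto)
  moreover have "quotient_norm (PiE I X) (C_tilde I X i) f \<le> sup_norm (PiE I X) (\<lambda>x. f x - k x)"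
    unfolding quotient_norm_def
    by (rule cINF_lower[OF _ k]) (auto intro!: bdd_belowI[of _ 0] sup_norm_nonneg fin)
  ultimately show ?thesis
    unfolding L_coord_def by simp
qed

lemma L_coord_nonneg: "finite (PiE I X) \<Longrightarrow> 0 \<le> L_coord I X i f"
  unfolding L_coord_def quotient_norm_def
  by (auto intro!: cINF_greatest C_tilde_nonempty sup_norm_nonneg)

lemma hamming_dist_pos:
  assumes "finite I" "x \<in> PiE I X" "y \<in> PiE I X" "x \<noteq> y"
  shows "0 < hamming_dist I x y"
proof -
  \<comment> \<open>Elements of \<open>PiE I X\<close> agree outside \<open>I\<close> by
    extensionality, so distinct ones differ at some index in \<open>I\<close>.\<close>
  have "{i \<in> I. x i \<noteq> y i} \<noteq> {}"
    using assms PiE_ext by blast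
  then show ?thesis
    using assms unfolding hamming_dist_def by (simp add: card_gt_0_iff)
qed

lemma hamming_dist_le_1:
  assumes "\<And>j. j \<in> I - {i} \<Longrightarrow> x j = y j"
  shows "hamming_dist I x y \<le> 1"
proof -
  have "{j \<in> I. x j \<noteq> y j} \<subseteq> {i}"
    using assms by blast
  then have "card {j \<in> I. x j \<noteq> y j} \<le> card {i}"
    by (intro card_mono) auto
  then show ?thesis
    unfolding hamming_dist_def by simp
qed

text \<open>Induction on the distance, with \<open>y\<close> fixed: \<open>x\<close> moves towards
  \<open>y\<close> by one coordinate, at cost at most \<open>M\<close>.\<close>

lemma norm_diff_le_hamming_dist:
  assumes fin: "finite I"
    and step: "\<And>i x y. i \<in> I \<Longrightarrow> x \<in> PiE I X \<Longrightarrow> y \<in> PiE I X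
      \<Longrightarrow> (\<And>j. j \<in> I - {i} \<Longrightarrow> x j = y j) \<Longrightarrow> cmod (f x - f y) \<le> M"
    and "x \<in> PiE I X" and y: "y \<in> PiE I X"
  shows "cmod (f x - f y) \<le> M * real (hamming_dist I x y)"
  using \<open>x \<in> PiE I X\<close>
proof (induction "hamming_dist I x y" arbitrary: x)
  case 0
  then show ?case
    using hamming_dist_pos[OF fin _ y] by fastforce
next
  case (Suc n)
  then have "{i \<in> I. x i \<noteq> y i} \<noteq> {}"
    unfolding hamming_dist_def by (metis card.empty nat.distinct(1))
  then obtain i where i: "i \<in> I" "x i \<noteq> y i" by blast
  \<comment> \<open>Correcting coordinate \<open>i\<close> stays inside the product and removes
    exactly \<open>i\<close> from the set of disagreements.\<close>
  define x' where "x' = x(i := y i)"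
  have x': "x' \<in> PiE I X"
    using Suc.prems y i(1) unfolding x'_def by (auto simp: PiE_iff extensional_def)
  have "{j \<in> I. x' j \<noteq> y j} = {j \<in> I. x j \<noteq> y j} - {i}"
    unfolding x'_def by auto
  then have n: "n = hamming_dist I x' y"
    using Suc.hyps(2) i fin unfolding hamming_dist_def by simp
  have "cmod (f x - f y) \<le> cmod (f x - f x') + cmod (f x' - f y)"
    using norm_triangle_ineq[of "f x - f x'" "f x' - f y"] by simp
  also have "cmod (f x - f x') \<le> M"
    by (rule step[OF i(1) Suc.prems x']) (auto simp: x'_def)
  also have "cmod (f x' - f y) \<le> M * real n"
    using Suc.hyps(1)[OF n x'] n by simp
  finally show ?case
    using Suc.hyps(2)[symmetric] by (simp add: algebra_simps)
qed

theorem theorem9p1: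
  fixes I :: "'i set" and X :: "'i \<Rightarrow> 'a set" and f :: "('i \<Rightarrow> 'a) \<Rightarrow> complex"
  assumes "finite I"
    and "\<And>i. i \<in> I \<Longrightarrow> finite (X i)"
    and "f \<in> C (PiE I X)"
    and "\<And>x. x \<in> PiE I X \<Longrightarrow> f x \<in> \<real>"
  shows "L_H I X f = (if I = {} then 0 else Max ((\<lambda>i. L_coord I X i f) ` I))"
proof (cases "I = {}")
  case True
  \<comment> \<open>The empty product is a single point, so there are no pairs and
    \<open>sup0\<close> returns 0.\<close>
  then have "{cmod (f x - f y) / real (hamming_dist I x y) | x y.
      x \<in> PiE I X \<and> y \<in> PiE I X \<and> x \<noteq> y} = {}"
    by auto
  then show ?thesis
    unfolding L_H_def lipschitz_seminorm_def sup0_def using True by simp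
next
  case False
  have fin: "finite (PiE I X)"
    using assms(1,2) by (rule finite_PiE)
  define M where "M = Max ((\<lambda>i. L_coord I X i f) ` I)"
  have le_M: "L_coord I X i f \<le> M" if "i \<in> I" for i
    unfolding M_def using assms(1) that by simp
  \<comment> \<open>\<open>sup0_least\<close> asks for this, since the product may be empty or a
    single point.\<close>
  have "0 \<le> M"
    using False le_M L_coord_nonneg[OF fin] by (metis all_not_in_conv order_trans)
  have "cmod (f x - f y) / real (hamming_dist I x y) \<le> M"
    if "x \<in> PiE I X" "y \<in> PiE I X" "x \<noteq> y" for x y
  proof -
    have "cmod (f x - f y) \<le> M * real (hamming_dist I x y)"
      by (rule norm_diff_le_hamming_dist[OF assms(1) _ that(1,2)])
        (blast intro: order_trans[OF norm_diff_le_L_coord[OF fin] le_M])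
    then show ?thesis
      using hamming_dist_pos[OF assms(1) that] by (simp add: field_simps)
  qed
  then have "L_H I X f \<le> M"
    unfolding L_H_def lipschitz_seminorm_def by (intro sup0_least) (use \<open>0 \<le> M\<close> in auto)
  moreover have "L_coord I X i f \<le> L_H I X f" for i
  proof (rule L_coord_le[OF fin assms(4)])
    show nonneg: "0 \<le> L_H I X f"
      unfolding L_H_def by (rule lipschitz_seminorm_nonneg[OF fin]) simp
    fix x y
    assume xy: "x \<in> PiE I X" "y \<in> PiE I X" and eq: "\<And>j. j \<in> I - {i} \<Longrightarrow> x j = y j"
    show "cmod (f x - f y) \<le> L_H I X f"
    proof (cases "x = y")
      case True
      then show ?thesis using nonneg by simp
    next
      case False
      \<comment> \<open>Distinct points of a fibre are at distance exactly 1, so their Lipschitz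
        quotient is the oscillation itself.\<close>
      then have "0 < hamming_dist I x y"
        by (rule hamming_dist_pos[OF assms(1) xy])
      moreover from this have "hamming_dist I x y = 1"
        using hamming_dist_le_1[of I i x y] eq by fastforce
      ultimately show ?thesis
        using norm_diff_le_lipschitz_seminorm[OF fin xy False,
            of "\<lambda>x y. real (hamming_dist I x y)" f]
        unfolding L_H_def by simp
    qed
  qed
  then have "M \<le> L_H I X f"
    unfolding M_def using assms(1) False by simp
  ultimately show ?thesis
    using False unfolding M_def by simp
qed

end
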